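(* Let $\omega : \mathbb{D} \to (0,\infty)$ be a radial weight such that $1/\omega$ is equivalent to a log-convex function. Then, given any piecewise continuous, non-increasing function $W : [0,1) \to (0,\infty)$ with $\lim_{r \to 1^-} W(r) = 0$, there exist functions $f, g \in H_{\omega,0}^\infty$ such that $$|f(z)| + |g(z)| \geq \frac{W(|z|)}{\omega(|z|)} \quad \text{for all } z \in \mathbb{D}.$$
   Context: $\mathbb{D}$ is the open unit disc of $\mathbb{C}$. A radial weight $\omega$ is a continuous function $\omega:\mathbb{D}\to(0,\infty)$ such that $\omega(z) = \omega(|z|) < \omega(|w|) = \omega(w)$ for all $z,w \in \mathbb{D}$ with $|z| > |w|$ (so $\omega$ is radial and strictly decreasing in $|z|$), and $\lim_{|z|\to 1^-}\omega(z) = 0$. The weighted Hardy space (growth space) is $$H_\omega^\infty = \Big\{ f : \mathbb{D}\to\mathbb{C} \text{ analytic} : \|f\|_\omega := \sup_{z\in\mathbb{D}} \omega(z)|f(z)| < \infty \Big\},$$ and the corresponding space with little $o$ growth condition is $$H_{\omega,0}^\infty = \Big\{ f \in H_\omega^\infty : \lim_{|z|\to 1^-}\omega(z)|f(z)| = 0 \Big\}.$$ Two positive, radial functions $v$ and $w$ on $\mathbb{D}$ are equivalent if there exists a constant $C>0$ such that $v(z)/C \leq w(z) \leq C v(z)$ for all $z\in\mathbb{D}$. A positive radial function $v$ on $\mathbb{D}$ is log-convex if $\log v(r)$ is a convex function of $\log r$ for $r\in(0,1)$, that is, $x \mapsto \log v(e^x)$ is convex on $(-\infty,0)$. *)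

theory Defs
  imports "HOL-Complex_Analysis.Complex_Analysis"
begin

abbreviation unit_disc :: "complex set" where
  "unit_disc \<equiv> ball 0 1"

text \<open>The filter of the limit \<open>|z| \<rightarrow> 1-\<close>, uniform in the argument of \<open>z\<close>.\<close>

definition at_unit_circle :: "complex filter" where
  "at_unit_circle = filtercomap cmod (at_left 1)"

text \<open>Functions on the disc are total functions on \<open>complex\<close>; only their values on
  \<open>unit_disc\<close> are ever constrained or used.\<close>

definition positive_radial :: "(complex \<Rightarrow> real) \<Rightarrow> bool" where
  "positive_radial v \<longleftrightarrow>
     (\<forall>z\<in>unit_disc. v z > 0 \<and> v z = v (complex_of_real (cmod z)))"

definition radial_weight :: "(complex \<Rightarrow> real) \<Rightarrow> bool" where
  "radial_weight \<omega> \<longleftrightarrow>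
     continuous_on unit_disc \<omega> \<and> positive_radial \<omega> \<and>
     (\<forall>z\<in>unit_disc. \<forall>w\<in>unit_disc. cmod z > cmod w \<longrightarrow> \<omega> z < \<omega> w) \<and>
     (\<omega> \<longlongrightarrow> 0) at_unit_circle"

definition growth_norm :: "(complex \<Rightarrow> real) \<Rightarrow> (complex \<Rightarrow> complex) \<Rightarrow> ereal" where
  "growth_norm \<omega> f = (SUP z\<in>unit_disc. ereal (\<omega> z * cmod (f z)))"

definition growth_space :: "(complex \<Rightarrow> real) \<Rightarrow> (complex \<Rightarrow> complex) set" where
  "growth_space \<omega> = {f. f holomorphic_on unit_disc \<and> growth_norm \<omega> f < \<infinity>}"

definition little_growth_space :: "(complex \<Rightarrow> real) \<Rightarrow> (complex \<Rightarrow> complex) set" where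
  "little_growth_space \<omega> =
     {f \<in> growth_space \<omega>. ((\<lambda>z. \<omega> z * cmod (f z)) \<longlongrightarrow> 0) at_unit_circle}"

definition equivalent_on_disc :: "(complex \<Rightarrow> real) \<Rightarrow> (complex \<Rightarrow> real) \<Rightarrow> bool" where
  "equivalent_on_disc v w \<longleftrightarrow>
     (\<exists>C>0. \<forall>z\<in>unit_disc. v z / C \<le> w z \<and> w z \<le> C * v z)"

text \<open>Convexity of \<open>log v(r)\<close> in \<open>log r\<close> for \<open>0 < r < 1\<close>; no condition links \<open>v 0\<close> to the
  other values of \<open>v\<close>.\<close>

definition log_convex :: "(complex \<Rightarrow> real) \<Rightarrow> bool" where
  "log_convex v \<longleftrightarrow>
     positive_radial v \<and> convex_on {..<0} (\<lambda>x. ln (v (complex_of_real (exp x))))"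

text \<open>On a non-compact interval the discontinuities may accumulate at a missing endpoint:
  only finitely many of them are required in each compact subinterval.\<close>

definition piecewise_continuous_on :: "real set \<Rightarrow> (real \<Rightarrow> real) \<Rightarrow> bool" where
  "piecewise_continuous_on I h \<longleftrightarrow>
     (\<forall>a b. {a..b} \<subseteq> I \<longrightarrow>
        (\<exists>S. finite S \<and> continuous_on ({a..b} - S) h) \<and>
        (\<forall>s\<in>{a<..b}. \<exists>l. (h \<longlongrightarrow> l) (at_left s)) \<and>
        (\<forall>s\<in>{a..<b}. \<exists>l. (h \<longlongrightarrow> l) (at_right s)))"

end

theory Submission
  imports Defs
begin

text \<open>
  Let \<open>v\<close> be the log-convex function equivalent to \<open>1/\<omega>\<close>. For \<open>n \<ge> 1\<close> let \<open>T\<^sub>n(r) = b\<^sub>n r\<^sup>n\<close>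
  be the largest monomial below \<open>v\<close>; it touches \<open>v\<close> at a point \<open>x\<^sub>n\<close>, and by log-convexity
  \<open>T\<^sub>n/v\<close> increases before and decreases after \<open>x\<^sub>n\<close>. Choose exponents greedily: when \<open>T\<^sub>n\<close> has
  dropped to \<open>v/32\<close>, at a point \<open>\<rho> > x\<^sub>n\<close>, move on to the first \<open>T\<^sub>k\<close> that is still at most \<open>v/32\<close>
  at \<open>\<rho>\<close> and touches \<open>v\<close> later. Between consecutive points \<open>\<rho>\<close> the current monomial is comparable
  to \<open>v\<close> and dominates the sum of all the others except its two neighbours. The even-numbered
  terms therefore form one series and the odd-numbered terms the other. The coefficients are
  multiplied by a null sequence that lies above \<open>W\<close> on the respective interval and decays slowly
  enough to keep this domination.\<close>

section \<open>Convexity on segments and comparison of two monomials\<close>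

text \<open>Used with \<open>\<xi>\<close> a minimum point of \<open>g\<close>: a convex function on
  a segment is at most its larger endpoint value, so \<open>g\<close> is non-increasing from any
  \<open>y\<close> towards \<open>\<xi>\<close>.\<close>

lemma convex_on_le_endpoint:
  fixes g :: "real \<Rightarrow> real"
  assumes "convex_on S g" "y \<in> S" "\<xi> \<in> S" "g \<xi> \<le> g y" "z \<in> closed_segment y \<xi>"
  shows "g z \<le> g y"
proof -
  obtain t where t: "0 \<le> t" "t \<le> 1" "z = (1 - t) *\<^sub>R y + t *\<^sub>R \<xi>"
    using assms(5) by (auto simp: closed_segment_def)
  have "g z \<le> max (g y) (g \<xi>)"
    unfolding t(3) by (rule convex_lower[OF assms(1-3)]) (use t in auto)
  then show ?thesis using assms(4) by simp
qed

text \<open>Cancelling \<open>s ^ i\<close> leaves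
  \<open>\<beta> * s ^ (j - i) \<le> \<alpha>\<close>, which persists for every smaller
  \<open>r\<close>. The common shift by \<open>N\<close> later brings the first exponent down to
  zero.\<close>

lemma monomial_le_below:
  fixes \<alpha> \<beta> r s :: real
  assumes "\<beta> * s ^ j \<le> \<alpha> * s ^ i" "N \<le> i" "i \<le> j" "0 \<le> r" "r \<le> s" "0 < s" "0 \<le> \<beta>"
  shows "\<beta> * r ^ (j - N) \<le> \<alpha> * r ^ (i - N)"
proof -
  have j: "j = i + (j - i)" "j - N = (i - N) + (j - i)" using assms by auto
  have "(\<beta> * s ^ (j - i)) * s ^ i \<le> \<alpha> * s ^ i"
    using assms(1) by (subst (asm) j(1)) (simp add: power_add algebra_simps)
  then have "\<beta> * s ^ (j - i) \<le> \<alpha>" using assms by simp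
  moreover have "\<beta> * r ^ (j - i) \<le> \<beta> * s ^ (j - i)"
    using assms by (intro mult_left_mono power_mono) auto
  ultimately have "(\<beta> * r ^ (j - i)) * r ^ (i - N) \<le> \<alpha> * r ^ (i - N)"
    using assms by (intro mult_right_mono) auto
  then show ?thesis by (subst j(2)) (simp add: power_add algebra_simps)
qed

lemma monomial_le_above:
  fixes \<alpha> \<beta> r s :: real
  assumes "\<alpha> * s ^ i \<le> \<beta> * s ^ j" "N \<le> i" "i \<le> j" "s \<le> r" "0 < s" "0 \<le> \<beta>"
  shows "\<alpha> * r ^ (i - N) \<le> \<beta> * r ^ (j - N)"
proof -
  have j: "j = i + (j - i)" "j - N = (i - N) + (j - i)" using assms by auto
  have "\<alpha> * s ^ i \<le> (\<beta> * s ^ (j - i)) * s ^ i"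
    using assms(1) by (subst (asm) j(1)) (simp add: power_add algebra_simps)
  then have "\<alpha> \<le> \<beta> * s ^ (j - i)" using assms by simp
  also have "\<dots> \<le> \<beta> * r ^ (j - i)"
    using assms by (intro mult_left_mono power_mono) auto
  finally have "\<alpha> * r ^ (i - N) \<le> (\<beta> * r ^ (j - i)) * r ^ (i - N)"
    using assms by (intro mult_right_mono) auto
  then show ?thesis unfolding j(2) by (simp add: power_add algebra_simps)
qed

text \<open>The exponents are shifted so that \<open>d 0 = 0\<close>: the first monomial then dominates down to the
  origin, where the unshifted series would vanish.\<close>

locale lacunary_monomials =
  fixes b :: "nat \<Rightarrow> real" and d :: "nat \<Rightarrow> nat" and \<rho> :: "nat \<Rightarrow> real"
  assumes d_0: "d 0 = 0"
    and b_pos: "0 < b k"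
    and \<rho>_half: "1 / 2 \<le> \<rho> k" and \<rho>_less: "\<rho> k < 1"
    and \<rho>_mono: "incseq \<rho>" and \<rho>_lim: "\<rho> \<longlonglongrightarrow> 1"
    and up: "\<lbrakk>0 \<le> r; r \<le> \<rho> k\<rbrakk> \<Longrightarrow> b (Suc k) * r ^ d (Suc k) \<le> b k * r ^ d k"
    and up_fast: "\<lbrakk>0 \<le> r; r \<le> \<rho> k\<rbrakk> \<Longrightarrow>
      32 * (b (Suc (Suc k)) * r ^ d (Suc (Suc k))) \<le> b (Suc k) * r ^ d (Suc k)"
    and down: "\<rho> k \<le> r \<Longrightarrow> b k * r ^ d k \<le> 2 * (b (Suc k) * r ^ d (Suc k))"
    and down_fast: "\<rho> (Suc k) \<le> r \<Longrightarrow> 32 * (b k * r ^ d k) \<le> b (Suc k) * r ^ d (Suc k)"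

section \<open>Monomials touching a log-convex function from below\<close>

text \<open>\<open>V\<close> is the radial profile of the function equivalent to
  \<open>1 / \<omega>\<close>. Log-convexity alone would allow decay at the origin like that of a
  power of \<open>r\<close>; the bound \<open>m\<close> excludes it, so that
  \<open>V r / r ^ n\<close> becomes large towards 0.\<close>

locale log_convex_growth =
  fixes V :: "real \<Rightarrow> real" and m :: real
  assumes log_convex: "convex_on {..<0} (\<lambda>x. ln (V (exp x)))"
    and m_pos: "0 < m"
    and lower_bound: "\<lbrakk>0 < r; r < 1\<rbrakk> \<Longrightarrow> m \<le> V r"
    and blowup: "filterlim V at_top (at_left 1)"
begin

lemma V_pos: "\<lbrakk>0 < r; r < 1\<rbrakk> \<Longrightarrow> 0 < V r"
  using lower_bound m_pos by fastforce

lemma V_continuous: "continuous_on {0<..<1} V"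
proof -
  have "continuous_on {..<0} (\<lambda>x. ln (V (exp x)))"
    by (rule convex_on_continuous) (auto intro: log_convex)
  then have "continuous_on {0<..<1} (\<lambda>r. ln (V (exp (ln r))))"
    by (rule continuous_on_compose2) (auto intro!: continuous_intros)
  then have "continuous_on {0<..<1} (\<lambda>r. exp (ln (V (exp (ln r)))))"
    by (rule continuous_on_exp)
  then show ?thesis
    by (rule continuous_on_eq) (auto simp: V_pos)
qed

lemma ex_V_greater: "\<exists>a. 0 < a \<and> a < 1 \<and> (\<forall>r. a < r \<longrightarrow> r < 1 \<longrightarrow> M < V r)"
proof -
  have "eventually (\<lambda>r. M < V r) (at_left 1)"
    using blowup by (simp add: filterlim_at_top_dense)
  then obtain a where "a < 1" "\<forall>r>a. r < 1 \<longrightarrow> M < V r"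
    by (auto simp: eventually_at_left_field)
  then show ?thesis
    by (intro exI[of _ "max a (1/2)"]) auto
qed

text \<open>In the variable \<open>y = ln r\<close> the logarithm of \<open>V r / r ^ n\<close> is
  the convex function \<open>g\<close>. It has a global minimum, which gives the touching point, and
  it is monotone on either side of it. Both monotonicity claims are stated cross-multiplied.\<close>

lemma ex_touching_point:
  fixes n :: nat
  assumes n: "1 \<le> n"
  shows "\<exists>x. 0 < x \<and> x < 1 \<and>
    (\<forall>r s. 0 < r \<longrightarrow> r \<le> s \<longrightarrow> s \<le> x \<longrightarrow> r ^ n * V s \<le> s ^ n * V r) \<and>
    (\<forall>r s. x \<le> r \<longrightarrow> r \<le> s \<longrightarrow> s < 1 \<longrightarrow> s ^ n * V r \<le> r ^ n * V s)"
proof -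
  define g where "g y = ln (V (exp y)) - real n * y" for y
  have g_conv: "convex_on {..<0} g"
    unfolding g_def
    by (intro convex_on_diff log_convex) (auto simp: concave_on_def convex_on_def algebra_simps)
  have g_cont: "continuous_on {..<0} g"
    by (rule convex_on_continuous) (auto intro: g_conv)
  have g_ge: "ln m - real n * y \<le> g y" if "y < 0" for y
    using lower_bound[of "exp y"] m_pos that by (auto simp: g_def)
  \<comment> \<open>Left of \<open>\<alpha>\<close> the bound \<open>m\<close>, and right of
    \<open>\<beta>\<close> the blowup of \<open>V\<close>, force \<open>g\<close> above
    \<open>g (-1)\<close>. Since \<open>-1\<close> lies in the compact interval between them, the
    minimum found there is global.\<close>
  define \<alpha> where "\<alpha> = (ln m - g (-1)) / real n"
  obtain a where a: "0 < a" "a < 1" "\<And>r. a < r \<Longrightarrow> r < 1 \<Longrightarrow> exp (g (-1)) < V r"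
    using ex_V_greater by blast
  define \<beta> where "\<beta> = max (-1) (ln a)"
  have "\<alpha> \<le> -1"
    using g_ge[of "-1"] n by (auto simp: \<alpha>_def field_simps)
  have "\<beta> < 0" "-1 \<le> \<beta>" using a by (auto simp: \<beta>_def)
  have "\<exists>\<xi>\<in>{\<alpha>..\<beta>}. \<forall>y\<in>{\<alpha>..\<beta>}. g \<xi> \<le> g y"
    by (rule continuous_attains_inf)
      (use \<open>\<alpha> \<le> -1\<close> \<open>-1 \<le> \<beta>\<close> \<open>\<beta> < 0\<close> in \<open>auto intro: continuous_on_subset[OF g_cont]\<close>)
  then obtain \<xi> where \<xi>: "\<alpha> \<le> \<xi>" "\<xi> \<le> \<beta>" and min: "\<And>y. \<alpha> \<le> y \<Longrightarrow> y \<le> \<beta> \<Longrightarrow> g \<xi> \<le> g y"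
    by auto
  have "\<xi> < 0" using \<xi> \<open>\<beta> < 0\<close> by simp
  have gmin: "g \<xi> \<le> g y" if "y < 0" for y
  proof -
    have at1: "g \<xi> \<le> g (-1)" using min \<open>\<alpha> \<le> -1\<close> \<open>-1 \<le> \<beta>\<close> by simp
    consider "y < \<alpha>" | "\<alpha> \<le> y" "y \<le> \<beta>" | "\<beta> < y" by linarith
    then show ?thesis
    proof cases
      case 1
      then have "g (-1) < ln m - real n * y" using n by (simp add: \<alpha>_def field_simps)
      then show ?thesis using g_ge[OF that] at1 by linarith
    next
      case 3
      then have "ln a < y" by (simp add: \<beta>_def)
      then have "a < exp y" using a(1) by (metis exp_less_cancel_iff exp_ln)
      then have *: "exp (g (-1)) < V (exp y)" using a(3) that by simp
      then have "g (-1) < ln (V (exp y))"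
        by (metis exp_gt_zero less_trans ln_exp ln_less_cancel_iff)
      also have "\<dots> \<le> g y" using that n by (simp add: g_def mult_nonneg_nonpos)
      finally show ?thesis using at1 by linarith
    qed (use min in auto)
  qed
  have transfer: "r ^ n * V s \<le> s ^ n * V r"
    if "0 < r" "r < 1" "0 < s" "s < 1" "g (ln s) \<le> g (ln r)" for r s
  proof -
    have "ln (V s) + real n * ln r \<le> ln (V r) + real n * ln s"
      using that by (simp add: g_def)
    then have "ln (r ^ n * V s) \<le> ln (s ^ n * V r)"
      using that V_pos[of r] V_pos[of s] by (simp add: ln_mult ln_realpow)
    then show ?thesis
      using that V_pos[of r] V_pos[of s] by (subst (asm) ln_le_cancel_iff) auto
  qed
  have mono: "g z \<le> g y" if "y < 0" "z \<in> closed_segment y \<xi>" for y z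
    by (rule convex_on_le_endpoint[OF g_conv _ _ gmin]) (use that \<open>\<xi> < 0\<close> in auto)
  show ?thesis
  proof (intro exI[of _ "exp \<xi>"] conjI allI impI)
    fix r s :: real assume *: "0 < r" "r \<le> s" "s \<le> exp \<xi>"
    have "s < 1" using * \<open>\<xi> < 0\<close> by (meson exp_less_one_iff le_less_trans)
    have "ln s \<le> \<xi>" using * by (metis exp_gt_zero ln_exp ln_le_cancel_iff less_le_trans)
    moreover have "ln r \<le> ln s" using * by simp
    ultimately have "ln s \<in> closed_segment (ln r) \<xi>"
      by (simp only: closed_segment_eq_real_ivl) (auto simp del: ln_le_cancel_iff)
    then show "r ^ n * V s \<le> s ^ n * V r"
      using * \<open>s < 1\<close> by (intro transfer mono) auto
  next
    fix r s :: real assume *: "exp \<xi> \<le> r" "r \<le> s" "s < 1"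
    have "0 < r" using * by (meson exp_gt_zero less_le_trans)
    have "\<xi> \<le> ln r" using * \<open>0 < r\<close> by (metis exp_gt_zero ln_exp ln_le_cancel_iff)
    moreover have "ln r \<le> ln s" using * \<open>0 < r\<close> by simp
    ultimately have "ln r \<in> closed_segment (ln s) \<xi>"
      by (simp only: closed_segment_eq_real_ivl) (auto simp del: ln_le_cancel_iff)
    then show "s ^ n * V r \<le> r ^ n * V s"
      using * \<open>0 < r\<close> by (intro transfer mono) auto
  qed (use \<open>\<xi> < 0\<close> in auto)
qed

text \<open>The minimizer need not be unique; later arguments use only the properties listed
  here.\<close>

definition touch :: "nat \<Rightarrow> real" where
  "touch n = (SOME x. 0 < x \<and> x < 1 \<and>
    (\<forall>r s. 0 < r \<longrightarrow> r \<le> s \<longrightarrow> s \<le> x \<longrightarrow> r ^ n * V s \<le> s ^ n * V r) \<and>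
    (\<forall>r s. x \<le> r \<longrightarrow> r \<le> s \<longrightarrow> s < 1 \<longrightarrow> s ^ n * V r \<le> r ^ n * V s))"

text \<open>The largest \<open>c\<close> with \<open>c * r ^ n \<le> V r\<close> for
  \<open>0 < r < 1\<close>; equality is attained at \<open>touch n\<close>.\<close>

definition coef :: "nat \<Rightarrow> real" where
  "coef n = V (touch n) / touch n ^ n"

context
  fixes n :: nat assumes n: "1 \<le> n"
begin

lemma touch_pos: "0 < touch n" and touch_less_1: "touch n < 1"
  and ratio_antimono: "\<lbrakk>0 < r; r \<le> s; s \<le> touch n\<rbrakk> \<Longrightarrow> r ^ n * V s \<le> s ^ n * V r"
  and ratio_mono: "\<lbrakk>touch n \<le> r; r \<le> s; s < 1\<rbrakk> \<Longrightarrow> s ^ n * V r \<le> r ^ n * V s"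
  using someI_ex[OF ex_touching_point[OF n]] unfolding touch_def[symmetric] by blast+

lemma coef_pos: "0 < coef n"
  using touch_pos touch_less_1 V_pos by (simp add: coef_def)

lemma coef_touch: "coef n * touch n ^ n = V (touch n)"
  using touch_pos by (simp add: coef_def)

lemma coef_le:
  assumes "0 < r" "r < 1" shows "coef n * r ^ n \<le> V r"
proof -
  have "r ^ n * V (touch n) \<le> touch n ^ n * V r"
    using ratio_antimono[of r "touch n"] ratio_mono[of "touch n" r] assms touch_less_1
    by (cases "r \<le> touch n") auto
  then show ?thesis using touch_pos by (simp add: coef_def field_simps)
qed

text \<open>By the intermediate value theorem: \<open>h\<close> is negative at the touching point,
  where the monomial equals \<open>V\<close>, and positive near 1, where \<open>V\<close> is
  unbounded but the monomial stays below \<open>coef n\<close>.\<close>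

lemma ex_exit: "\<exists>\<rho>. touch n < \<rho> \<and> \<rho> < 1 \<and> 32 * coef n * \<rho> ^ n = V \<rho>"
proof -
  obtain a where a: "0 < a" "a < 1" "\<And>r. a < r \<Longrightarrow> r < 1 \<Longrightarrow> 32 * coef n < V r"
    using ex_V_greater by blast
  define s where "s = (1 + max a (touch n)) / 2"
  have s: "touch n < s" "s < 1" "a < s" using a touch_less_1 by (auto simp: s_def)
  have "0 < s" using s touch_pos by simp
  define h where "h r = V r - 32 * coef n * r ^ n" for r
  have "\<exists>\<rho>\<ge>touch n. \<rho> \<le> s \<and> h \<rho> = 0"
  proof (rule IVT')
    show "h (touch n) \<le> 0"
      using coef_touch V_pos[OF touch_pos touch_less_1] by (simp add: h_def)
    have "coef n * s ^ n \<le> coef n * 1"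
      using s \<open>0 < s\<close> coef_pos by (intro mult_left_mono power_le_one) auto
    then show "0 \<le> h s" using a(3)[OF s(3,2)] by (simp add: h_def)
    show "continuous_on {touch n..s} h" unfolding h_def
      using touch_pos s by (intro continuous_intros continuous_on_subset[OF V_continuous]) auto
  qed (use s in auto)
  then obtain \<rho> where \<rho>: "touch n \<le> \<rho>" "\<rho> \<le> s" "h \<rho> = 0" by blast
  have "\<rho> \<noteq> touch n"
    using coef_touch V_pos[OF touch_pos touch_less_1] \<rho>(3) touch_pos by (auto simp: h_def)
  then have "touch n < \<rho>" "\<rho> < 1" using \<rho> s by auto
  then show ?thesis using \<rho>(3) by (intro exI[of _ \<rho>]) (simp add: h_def)
qed

end

definition exit :: "nat \<Rightarrow> real" where
  "exit n = (SOME \<rho>. touch n < \<rho> \<and> \<rho> < 1 \<and> 32 * coef n * \<rho> ^ n = V \<rho>)"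

lemma
  assumes n: "1 \<le> n"
  shows exit_greater: "touch n < exit n" and exit_less_1: "exit n < 1"
    and coef_exit: "32 * coef n * exit n ^ n = V (exit n)"
  using someI_ex[OF ex_exit[OF n]] unfolding exit_def[symmetric] by blast+

section \<open>Order of the touching points and choice of the next exponent\<close>

text \<open>Each monomial is at most \<open>V\<close> and meets it at its own touching point. So the
  \<open>j\<close>-th is at most the \<open>i\<close>-th at \<open>touch i\<close>, and the reverse
  holds at \<open>touch j\<close>; their quotient is a constant times \<open>r ^ (j - i)\<close>,
  which increases.\<close>

lemma touch_mono:
  assumes "1 \<le> i" "i \<le> j" shows "touch i \<le> touch j"
proof (cases "i = j")
  case False
  have j: "1 \<le> j" using assms by simp
  note pos = touch_pos[OF assms(1)] touch_pos[OF j] touch_less_1[OF assms(1)] touch_less_1[OF j]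
  have "coef j * touch i ^ j \<le> coef i * touch i ^ i"
    using coef_le[OF j pos(1,3)] coef_touch[OF assms(1)] by simp
  then have 1: "coef j * touch i ^ (j - i) \<le> coef i"
    by (rule monomial_le_below[where N=i and s="touch i" and i=i and j=j, simplified])
      (use assms pos coef_pos[OF j] in \<open>auto intro: less_imp_le\<close>)
  have "coef i * touch j ^ i \<le> coef j * touch j ^ j"
    using coef_le[OF assms(1) pos(2,4)] coef_touch[OF j] by simp
  then have "coef i \<le> coef j * touch j ^ (j - i)"
    by (rule monomial_le_above[where N=i and s="touch j" and i=i and j=j, simplified])
      (use assms pos coef_pos[OF j] in \<open>auto intro: less_imp_le\<close>)
  then have "touch i ^ (j - i) \<le> touch j ^ (j - i)"
    using 1 coef_pos[OF j] by (metis mult_le_cancel_left_pos order_trans)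
  then show ?thesis
    using False assms pos by (simp add: power_mono_iff)
qed simp

lemma coef_mono_Suc:
  assumes "1 \<le> i" shows "coef i \<le> coef (Suc i)"
proof -
  let ?x = "touch (Suc i)"
  have x: "0 < ?x" "?x < 1" using touch_pos[of "Suc i"] touch_less_1[of "Suc i"] by auto
  have "coef i * ?x ^ i \<le> (coef (Suc i) * ?x) * ?x ^ i"
    using coef_le[OF assms x] coef_touch[of "Suc i"] by (simp add: mult.assoc)
  then have "coef i \<le> coef (Suc i) * ?x" using x by simp
  also have "\<dots> \<le> coef (Suc i) * 1"
    using x coef_pos[of "Suc i"] by (intro mult_left_mono) auto
  finally show ?thesis by simp
qed

text \<open>For \<open>s\<close> between \<open>\<rho>\<close> and 1 the \<open>k\<close>-th
  monomial is at most \<open>V s\<close> at \<open>s\<close>, hence at most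
  \<open>V s * (\<rho> / s) ^ k\<close> at \<open>\<rho>\<close>, which tends to 0. A touching point
  at or before \<open>\<rho>\<close> would instead make it at least \<open>m\<close> there.\<close>

lemma ex_far_index:
  assumes "0 < \<rho>" "\<rho> < 1"
  shows "\<exists>k\<ge>1. \<rho> < touch k \<and> 32 * coef k * \<rho> ^ k \<le> V \<rho>"
proof -
  define s where "s = (1 + \<rho>) / 2"
  have s: "0 < s" "s < 1" "\<rho> < s" using assms by (auto simp: s_def)
  have "(\<lambda>k. V s * (\<rho> / s) ^ k) \<longlonglongrightarrow> V s * 0"
    using s assms by (intro tendsto_intros LIMSEQ_power_zero) auto
  then have "eventually (\<lambda>k. V s * (\<rho> / s) ^ k < m / 32) sequentially"
    using m_pos by (intro order_tendstoD(2)) auto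
  then obtain k where k: "1 \<le> k" "V s * (\<rho> / s) ^ k < m / 32"
    using eventually_happens[OF eventually_conj[OF eventually_ge_at_top[of 1]]] by force
  have "coef k * s ^ k * (\<rho> / s) ^ k \<le> V s * (\<rho> / s) ^ k"
    using coef_le[OF k(1) s(1,2)] s assms by (intro mult_right_mono) auto
  moreover have "coef k * s ^ k * (\<rho> / s) ^ k = coef k * \<rho> ^ k"
    using s by (simp add: power_divide)
  ultimately have small: "coef k * \<rho> ^ k < m / 32"
    using k(2) by linarith
  have "\<rho> < touch k"
  proof (rule ccontr)
    assume "\<not> \<rho> < touch k"
    then have "coef k * touch k ^ k \<le> coef k * \<rho> ^ k"
      using coef_pos[OF k(1)] touch_pos[OF k(1)] by (intro mult_left_mono power_mono) auto
    then show False
      using small coef_touch[OF k(1)] lower_bound[OF touch_pos[OF k(1)] touch_less_1[OF k(1)]] m_pos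
      by simp
  qed
  then show ?thesis using k(1) small lower_bound[OF assms] by (intro exI[of _ k]) auto
qed

text \<open>Taking the least index matters: the failure of the index before it bounds
  \<open>V\<close> from above in \<open>V_exit_le\<close>.\<close>

definition succ :: "nat \<Rightarrow> nat" where
  "succ n = (LEAST k. 1 \<le> k \<and> exit n < touch k \<and> 32 * coef k * exit n ^ k \<le> V (exit n))"

section \<open>Comparison of consecutive monomials with each other and with \<open>V\<close>\<close>

context
  fixes n :: nat assumes n: "1 \<le> n" "1 / 2 \<le> touch n"
begin

lemma exit_pos: "0 < exit n"
  using exit_greater[OF n(1)] n(2) by linarith

lemma succ_ge_1: "1 \<le> succ n" and exit_less_touch_succ: "exit n < touch (succ n)"
  and coef_succ_exit: "32 * coef (succ n) * exit n ^ succ n \<le> V (exit n)"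
  using LeastI_ex[OF ex_far_index[OF exit_pos exit_less_1[OF n(1)]]]
  unfolding succ_def[symmetric] by blast+

lemma succ_greater: "n < succ n"
  using touch_mono[OF succ_ge_1, of n] exit_less_touch_succ exit_greater[OF n(1)]
  by (meson less_le_not_le linorder_not_less order_less_trans)

text \<open>The index \<open>k\<close> just before \<open>succ n\<close> violates one of the
  defining conditions, and either violation gives
  \<open>V \<rho> \<le> 32 * coef k * \<rho> ^ k\<close>. Passing from \<open>k\<close> to
  \<open>Suc k\<close> costs a factor 2, because \<open>\<rho> \<ge> 1 / 2\<close> and the
  coefficients do not decrease.\<close>

lemma V_exit_le: "V (exit n) \<le> 64 * coef (succ n) * exit n ^ succ n"
proof -
  define k where "k = succ n - 1"
  define \<rho> where "\<rho> = exit n"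
  have k: "succ n = Suc k" "n \<le> k" "1 \<le> k" using succ_greater n(1) by (auto simp: k_def)
  have \<rho>: "1 / 2 \<le> \<rho>" "\<rho> < 1" using exit_greater[OF n(1)] exit_less_1[OF n(1)] n(2) by (auto simp: \<rho>_def)
  have "\<not> (1 \<le> k \<and> \<rho> < touch k \<and> 32 * coef k * \<rho> ^ k \<le> V \<rho>)"
    unfolding \<rho>_def by (rule not_less_Least) (use k(1) in \<open>simp add: succ_def\<close>)
  then consider "touch k \<le> \<rho>" | "V \<rho> < 32 * coef k * \<rho> ^ k" using k by fastforce
  then have "V \<rho> \<le> 32 * coef k * \<rho> ^ k"
  proof cases
    \<comment> \<open>Here \<open>\<rho>\<close> lies between the touching points of
      \<open>k\<close> and \<open>Suc k\<close>, so \<open>V r / r ^ Suc k\<close> is non-increasing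
      from \<open>x\<close> to \<open>\<rho>\<close>; the bound \<open>1 / 2 \<le> x\<close> then
      yields even a factor 2 in place of 32.\<close>
    case 1
    define x where "x = touch k"
    have x: "1 / 2 \<le> x" "x \<le> \<rho>" using 1 n(2) touch_mono[OF n(1) k(2)] by (auto simp: x_def)
    have "x ^ Suc k * V \<rho> \<le> \<rho> ^ Suc k * V x"
      using ratio_antimono[of "Suc k" x \<rho>] x exit_less_touch_succ by (auto simp: \<rho>_def k(1))
    also have "V x = coef k * x ^ k" using coef_touch[OF k(3)] by (simp add: x_def)
    finally have "x ^ k * (x * V \<rho>) \<le> x ^ k * (coef k * \<rho> ^ k * \<rho>)" by (simp add: algebra_simps)
    then have "x * V \<rho> \<le> coef k * \<rho> ^ k * \<rho>" using x by simp
    also have "\<dots> \<le> coef k * \<rho> ^ k * 1"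
      using \<rho> coef_pos[OF k(3)] by (intro mult_left_mono) auto
    finally have "x * V \<rho> \<le> coef k * \<rho> ^ k" by simp
    moreover have "1 / 2 * V \<rho> \<le> x * V \<rho>" using x V_pos[of \<rho>] \<rho> by (intro mult_right_mono) auto
    moreover have "0 \<le> coef k * \<rho> ^ k" using \<rho> coef_pos[OF k(3)] by simp
    ultimately show ?thesis by linarith
  qed simp
  also have "coef k * \<rho> ^ k \<le> coef (Suc k) * \<rho> ^ k"
    using \<rho> coef_mono_Suc[OF k(3)] by (intro mult_right_mono) auto
  then have "32 * coef k * \<rho> ^ k \<le> 32 * coef (Suc k) * \<rho> ^ k" by simp
  also have "1 / 2 * (32 * coef (Suc k) * \<rho> ^ k) \<le> \<rho> * (32 * coef (Suc k) * \<rho> ^ k)"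
    using \<rho> coef_pos[of "Suc k"] by (intro mult_right_mono) auto
  then have "32 * coef (Suc k) * \<rho> ^ k \<le> 64 * coef (Suc k) * \<rho> ^ Suc k" by simp
  finally show ?thesis by (simp add: \<rho>_def k(1))
qed

text \<open>The quotient of the new monomial by \<open>V\<close> is at most \<open>1 / 32\<close> at
  \<open>exit n\<close> and non-decreasing up to \<open>touch (succ n)\<close>, so it is at most
  \<open>1 / 32\<close> at the earlier point \<open>touch n\<close>, where the old monomial equals
  \<open>V\<close>.\<close>

lemma coef_succ_touch: "32 * (coef (succ n) * touch n ^ succ n) \<le> coef n * touch n ^ n"
proof -
  have pos: "0 < touch n" "0 < exit n" "0 < V (touch n)" "0 < V (exit n)"
    using n exit_pos exit_less_1[OF n(1)] touch_less_1[OF n(1)] by (auto intro!: V_pos)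
  have "touch n ^ succ n * V (exit n) \<le> exit n ^ succ n * V (touch n)"
    using pos exit_greater[OF n(1)] exit_less_touch_succ
    by (intro ratio_antimono succ_ge_1) auto
  then have "32 * coef (succ n) * (touch n ^ succ n * V (exit n))
      \<le> 32 * coef (succ n) * (exit n ^ succ n * V (touch n))"
    using coef_pos[OF succ_ge_1] by (intro mult_left_mono) auto
  also have "\<dots> = (32 * coef (succ n) * exit n ^ succ n) * V (touch n)" by simp
  also have "\<dots> \<le> V (exit n) * V (touch n)"
    using coef_succ_exit pos by (intro mult_right_mono) auto
  finally have "(32 * (coef (succ n) * touch n ^ succ n)) * V (exit n) \<le> V (touch n) * V (exit n)"
    by (simp add: algebra_simps)
  then show ?thesis using pos coef_touch[OF n(1)] by simp
qed

text \<open>Symmetrically, the quotient of the old monomial by \<open>V\<close> equals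
  \<open>1 / 32\<close> at \<open>exit n\<close> and does not increase afterwards.\<close>

lemma coef_touch_succ:
  "32 * (coef n * touch (succ n) ^ n) \<le> coef (succ n) * touch (succ n) ^ succ n"
proof -
  let ?y = "touch (succ n)"
  have y: "0 < ?y" "?y < 1" "exit n < ?y"
    using touch_pos touch_less_1 succ_ge_1 exit_less_touch_succ by auto
  have pos: "0 < V ?y" "0 < V (exit n)"
    using y exit_pos exit_less_1[OF n(1)] by (auto intro!: V_pos)
  have "?y ^ n * V (exit n) \<le> exit n ^ n * V ?y"
    using y exit_greater[OF n(1)] by (intro ratio_mono n) auto
  then have "32 * coef n * (?y ^ n * V (exit n)) \<le> 32 * coef n * (exit n ^ n * V ?y)"
    using coef_pos[OF n(1)] by (intro mult_left_mono) auto
  also have "\<dots> = V (exit n) * V ?y" using coef_exit[OF n(1)] by (simp add: mult.assoc[symmetric])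
  finally have "(32 * (coef n * ?y ^ n)) * V (exit n) \<le> V ?y * V (exit n)"
    by (simp add: algebra_simps)
  then show ?thesis using pos coef_touch[OF succ_ge_1] by simp
qed

text \<open>The quotient of \<open>V\<close> by the monomial falls up to
  \<open>touch (succ n)\<close> and rises after it, so it is largest at an end of the interval: at
  most 64 at the left end, and 32 at the right.\<close>

lemma V_le_coef_succ:
  assumes "exit n \<le> r" "r \<le> exit (succ n)"
  shows "V r \<le> 64 * (coef (succ n) * r ^ succ n)"
proof (cases "r \<le> touch (succ n)")
  case True
  have pos: "0 < r" "r < 1" using exit_pos assms True touch_less_1[OF succ_ge_1] by auto
  have "exit n ^ succ n * V r \<le> r ^ succ n * V (exit n)"
    using exit_pos assms True by (intro ratio_antimono succ_ge_1) auto
  also have "\<dots> \<le> r ^ succ n * (64 * coef (succ n) * exit n ^ succ n)"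
    using pos V_exit_le by (intro mult_left_mono) auto
  finally have "exit n ^ succ n * V r \<le> exit n ^ succ n * (64 * (coef (succ n) * r ^ succ n))"
    by (simp add: algebra_simps)
  then show ?thesis using exit_pos by simp
next
  case False
  let ?s = "exit (succ n)"
  have pos: "0 < r" "r < 1" "0 < ?s" "?s < 1"
    using exit_pos assms exit_less_1[OF succ_ge_1] by auto
  have "?s ^ succ n * V r \<le> r ^ succ n * V ?s"
    using assms False exit_less_1[OF succ_ge_1] by (intro ratio_mono succ_ge_1) auto
  also have "\<dots> = r ^ succ n * (32 * coef (succ n) * ?s ^ succ n)"
    using coef_exit[OF succ_ge_1] by simp
  finally have "?s ^ succ n * V r \<le> ?s ^ succ n * (32 * (coef (succ n) * r ^ succ n))"
    by (simp add: algebra_simps)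
  then have "V r \<le> 32 * (coef (succ n) * r ^ succ n)" using pos by simp
  moreover have "0 \<le> coef (succ n) * r ^ succ n" using pos coef_pos[OF succ_ge_1] by simp
  ultimately show ?thesis by linarith
qed

text \<open>Makes \<open>V\<close> grow geometrically along the exit points, which drives them to
  1.\<close>

lemma V_touch_le_V_exit: "32 * V (touch n) \<le> V (exit n)"
proof -
  have "coef n * touch n ^ n \<le> coef n * exit n ^ n"
    using exit_greater[OF n(1)] touch_pos[OF n(1)] coef_pos[OF n(1)]
    by (intro mult_left_mono power_mono) auto
  then show ?thesis using coef_touch[OF n(1)] coef_exit[OF n(1)] by simp
qed

end

lemma V_mono:
  assumes "1 \<le> n" "touch n \<le> r" "r \<le> s" "s < 1" shows "V r \<le> V s"
proof -
  have pos: "0 < r" "0 < V s" using assms touch_pos[OF assms(1)] by (auto intro!: V_pos)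
  have "s ^ n * V r \<le> r ^ n * V s" by (rule ratio_mono) (use assms in auto)
  also have "\<dots> \<le> s ^ n * V s"
    using assms pos by (intro mult_right_mono power_mono) auto
  finally show ?thesis using assms pos by simp
qed

section \<open>The lacunary sequence obtained by iterating the choice\<close>

proposition ex_lacunary_majorant:
  obtains b :: "nat \<Rightarrow> real" and d :: "nat \<Rightarrow> nat" and \<rho> :: "nat \<Rightarrow> real" and D :: real
  where "lacunary_monomials b d \<rho>"
    and "\<And>k r. \<lbrakk>\<rho> k \<le> r; r \<le> \<rho> (Suc k)\<rbrakk> \<Longrightarrow> V r \<le> 64 * (b (Suc k) * r ^ d (Suc k))"
    and "0 < D" "\<And>k r. \<lbrakk>1 / 2 \<le> r; r < 1\<rbrakk> \<Longrightarrow> b k * r ^ d k \<le> D * V r"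
proof -
  \<comment> \<open>Starting beyond \<open>1 / 2\<close> keeps all later touching points there, as
    the estimates for \<open>succ\<close> require.\<close>
  obtain N where N: "1 \<le> N" "1 / 2 < touch N"
    using ex_far_index[of "1 / 2"] by auto
  define n where "n k = (succ ^^ k) N" for k
  have n_Suc: "n (Suc k) = succ (n k)" for k by (simp add: n_def)
  have base: "1 \<le> n k \<and> 1 / 2 \<le> touch (n k) \<and> N \<le> n k" for k
  proof (induction k)
    case (Suc k)
    then show ?case
      using succ_greater[of "n k"] exit_less_touch_succ[of "n k"] exit_greater[of "n k"]
      by (simp add: n_Suc)
  qed (use N in \<open>auto simp: n_def\<close>)
  then have n1: "1 \<le> n k" and half: "1 / 2 \<le> touch (n k)" and N_le: "N \<le> n k" for k by auto
  have n_less: "n k \<le> n (Suc k)" for k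
    using succ_greater[OF n1 half, of k] by (simp add: n_Suc)
  define \<rho> where "\<rho> k = exit (n k)" for k
  have touch_less: "touch (n k) < \<rho> k" and less_touch: "\<rho> k < touch (n (Suc k))" for k
    using exit_greater[OF n1] exit_less_touch_succ[OF n1 half] by (auto simp: \<rho>_def n_Suc)
  have \<rho>_half: "1 / 2 \<le> \<rho> k" and \<rho>_less: "\<rho> k < 1" for k
    using half[of k] touch_less[of k] exit_less_1[OF n1[of k]] by (auto simp: \<rho>_def)
  have \<rho>_mono: "incseq \<rho>"
    using touch_less less_touch by (intro incseq_SucI) (meson less_imp_le less_trans)
  have touch_lt: "touch (n k) < 1" and touch_gt: "0 < touch (n k)" for k
    using touch_less_1[OF n1] touch_pos[OF n1] by auto
  have growth: "32 ^ k * V (touch N) \<le> V (\<rho> k)" for k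
  proof (induction k)
    case 0
    show ?case
      using V_touch_le_V_exit[OF n1 half, of 0] V_pos[OF touch_gt touch_lt, of 0]
      by (simp add: n_def \<rho>_def)
  next
    case (Suc k)
    have "V (\<rho> k) \<le> V (touch (n (Suc k)))"
      by (rule V_mono[OF n1[of k]]) (use touch_less[of k] less_touch[of k] touch_lt in auto)
    moreover have "32 * V (touch (n (Suc k))) \<le> V (\<rho> (Suc k))"
      using V_touch_le_V_exit[OF n1 half] by (simp add: \<rho>_def)
    ultimately show ?case using Suc.IH by simp
  qed
  have \<rho>_lim: "\<rho> \<longlonglongrightarrow> 1"
  proof (rule increasing_tendsto)
    fix a :: real assume "a < 1"
    define a' where "a' = max a (touch N)"
    have a': "a \<le> a'" "touch N \<le> a'" "a' < 1"
      using \<open>a < 1\<close> touch_less_1[OF N(1)] by (auto simp: a'_def)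
    have "0 < V (touch N)" using V_pos touch_pos touch_less_1 N(1) by blast
    then obtain K where K: "V a' / V (touch N) < 32 ^ K"
      using real_arch_pow[of 32 "V a' / V (touch N)"] by auto
    \<comment> \<open>Otherwise \<open>\<rho> K\<close> would lie between \<open>touch N\<close> and
      \<open>a'\<close>, where \<open>V\<close> is at most \<open>V a'\<close>, against the
      geometric growth.\<close>
    have "a' < \<rho> K"
    proof (rule ccontr)
      assume "\<not> a' < \<rho> K"
      moreover have "touch N \<le> \<rho> K"
        using touch_mono[OF N(1) N_le, of K] touch_less[of K] by simp
      ultimately have "V (\<rho> K) \<le> V a'"
        using a' by (intro V_mono[OF N(1)]) auto
      then show False
        using K growth[of K] \<open>0 < V (touch N)\<close> by (simp add: field_simps)
    qed
    then show "eventually (\<lambda>k. a < \<rho> k) sequentially"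
      using a'(1) incseqD[OF \<rho>_mono]
      by (intro eventually_sequentiallyI[of K]) (meson le_less_trans less_le_trans)
  qed (use \<rho>_less in \<open>auto intro!: always_eventually less_imp_le\<close>)
  define b where "b k = coef (n k)" for k
  define d where "d k = n k - N" for k
  have b_pos: "0 < b k" for k using coef_pos[OF n1] by (simp add: b_def)
  have exit_gt: "0 < \<rho> k" for k using \<rho>_half[of k] by linarith
  \<comment> \<open>At \<open>\<rho> k\<close> the current monomial is exactly \<open>V / 32\<close>
    and the next lies between \<open>V / 64\<close> and \<open>V / 32\<close>; hence the factors 1
    and 2.\<close>
  have up: "b (Suc k) * \<rho> k ^ n (Suc k) \<le> 1 * b k * \<rho> k ^ n k" for k
    using coef_succ_exit[OF n1 half, of k] coef_exit[OF n1, of k] by (simp add: b_def \<rho>_def n_Suc)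
  have down: "b k * \<rho> k ^ n k \<le> 2 * b (Suc k) * \<rho> k ^ n (Suc k)" for k
    using V_exit_le[OF n1 half, of k] coef_exit[OF n1, of k] by (simp add: b_def \<rho>_def n_Suc)
  have up': "32 * b (Suc k) * touch (n k) ^ n (Suc k) \<le> b k * touch (n k) ^ n k" for k
    using coef_succ_touch[OF n1 half, of k] by (simp add: b_def n_Suc)
  have down': "32 * b k * touch (n (Suc k)) ^ n k \<le> b (Suc k) * touch (n (Suc k)) ^ n (Suc k)" for k
    using coef_touch_succ[OF n1 half, of k] by (simp add: b_def n_Suc)
  have lac: "lacunary_monomials b d \<rho>"
  proof
    show "d 0 = 0" by (simp add: d_def n_def)
    show "b (Suc k) * r ^ d (Suc k) \<le> b k * r ^ d k" if "0 \<le> r" "r \<le> \<rho> k" for k r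
      using monomial_le_below[OF up N_le n_less that exit_gt] b_pos[of "Suc k"] by (simp add: d_def)
    show "b k * r ^ d k \<le> 2 * (b (Suc k) * r ^ d (Suc k))" if "\<rho> k \<le> r" for k r
      using monomial_le_above[OF down N_le n_less that exit_gt] b_pos[of "Suc k"] by (simp add: d_def)
    show "32 * (b (Suc (Suc k)) * r ^ d (Suc (Suc k))) \<le> b (Suc k) * r ^ d (Suc k)"
      if "0 \<le> r" "r \<le> \<rho> k" for k r
      using monomial_le_below[OF up' N_le n_less that(1) _ touch_gt, of "Suc k"] b_pos[of "Suc (Suc k)"]
        that(2) less_touch[of k] by (simp add: d_def)
    show "32 * (b k * r ^ d k) \<le> b (Suc k) * r ^ d (Suc k)" if "\<rho> (Suc k) \<le> r" for k r
      using monomial_le_above[OF down' N_le n_less _ touch_gt, of k r] b_pos[of "Suc k"]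
        that touch_less[of "Suc k"] by (simp add: d_def)
  qed (use b_pos \<rho>_half \<rho>_less \<rho>_mono \<rho>_lim in auto)
  show thesis
  proof (rule that[of b d \<rho> "2 ^ N", OF lac])
    have split: "b k * r ^ n k = (b k * r ^ d k) * r ^ N" for k r
      using N_le[of k] by (simp add: d_def flip: power_add)
    show "V r \<le> 64 * (b (Suc k) * r ^ d (Suc k))" if "\<rho> k \<le> r" "r \<le> \<rho> (Suc k)" for k r
    proof -
      have r: "0 \<le> r" "r \<le> 1" using that \<rho>_half[of k] \<rho>_less[of "Suc k"] by linarith+
      have "V r \<le> 64 * (b (Suc k) * r ^ n (Suc k))"
        using V_le_coef_succ[OF n1 half, of k r] that by (simp add: b_def n_Suc \<rho>_def)
      also have "b (Suc k) * r ^ n (Suc k) \<le> b (Suc k) * r ^ d (Suc k)"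
        using r b_pos[of "Suc k"] by (intro mult_left_mono power_decreasing) (auto simp: d_def)
      finally show ?thesis by simp
    qed
    show "b k * r ^ d k \<le> 2 ^ N * V r" if "1 / 2 \<le> r" "r < 1" for k r
    proof -
      \<comment> \<open>The factor \<open>2 ^ N\<close> pays for the \<open>N\<close> powers of
        \<open>r\<close> removed by the shift of exponents.\<close>
      have "1 \<le> 2 ^ N * r ^ N"
        using that one_le_power[of "2 * r" N] by (simp add: power_mult_distrib)
      then have "(b k * r ^ d k) * 1 \<le> (b k * r ^ d k) * (2 ^ N * r ^ N)"
        using b_pos[of k] that by (intro mult_left_mono) auto
      also have "\<dots> = 2 ^ N * (coef (n k) * r ^ n k)"
        unfolding b_def[symmetric] split by (simp only: mult_ac)
      also have "\<dots> \<le> 2 ^ N * V r"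
        using coef_le[OF n1] that by (intro mult_left_mono) auto
      finally show ?thesis by simp
    qed
  qed auto
qed

end

section \<open>Series dominated by a single term and its neighbours\<close>

text \<open>Geometric sums bound the terms beyond \<open>Suc k\<close> by \<open>p k / 15\<close>
  and those before the predecessor of \<open>k\<close> by \<open>4 * p k / 15\<close>. With the
  neighbours this totals less than \<open>7 * p k\<close>; when \<open>a\<close> vanishes at the
  neighbours, at least \<open>2 / 3\<close> of \<open>p k\<close> survives.\<close>

lemma
  fixes p :: "nat \<Rightarrow> real"
  assumes nonneg: "\<And>j. 0 \<le> p j"
    and next_le: "p (Suc k) \<le> p k"
    and right: "\<And>j. k < j \<Longrightarrow> 16 * p (Suc j) \<le> p j"
    and prev_le: "\<And>i. k = Suc i \<Longrightarrow> p i \<le> 4 * p k"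
    and left: "\<And>j. Suc j < k \<Longrightarrow> 16 * p j \<le> p (Suc j)"
  shows dominated_summable: "summable p"
    and dominated_suminf_le: "suminf p \<le> 7 * p k"
    and dominant_term_le_norm_suminf:
      "\<And>a :: nat \<Rightarrow> complex. \<lbrakk>\<And>j. norm (a j) \<le> p j; norm (a k) = p k; a (Suc k) = 0;
        \<And>i. k = Suc i \<Longrightarrow> a i = 0\<rbrakk> \<Longrightarrow> p k / 2 \<le> norm (suminf a)"
proof -
  have geo: "p (j + Suc k) \<le> p (Suc k) * (1 / 16) ^ j" for j
  proof (induction j)
    case (Suc j)
    then show ?case using right[of "j + Suc k"] by simp
  qed simp
  have geo_sum: "(\<lambda>j. p (Suc k) * (1 / 16) ^ j) sums (p (Suc k) * (16 / 15))"
    using sums_mult[OF geometric_sums[of "1 / 16 :: real"], of "p (Suc k)"] by simp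
  have "summable (\<lambda>j. p (j + Suc k))"
    by (rule summable_comparison_test'[OF sums_summable[OF geo_sum], of 0]) (use geo nonneg in auto)
  then show summ: "summable p" by (simp only: summable_iff_shift)
  have "(\<Sum>j. p (j + Suc k)) \<le> p (Suc k) * (16 / 15)"
    using suminf_le[OF geo \<open>summable (\<lambda>j. p (j + Suc k))\<close> sums_summable[OF geo_sum]]
      sums_unique[OF geo_sum] by simp
  moreover have "(\<Sum>j. p (j + Suc k)) = p (Suc k) + (\<Sum>j. p (j + Suc (Suc k)))"
    using suminf_split_head[OF \<open>summable (\<lambda>j. p (j + Suc k))\<close>] by simp
  ultimately have tail: "(\<Sum>j. p (j + Suc (Suc k))) \<le> p k / 15"
    using next_le by simp
  have lower: "m < k \<Longrightarrow> 15 * (\<Sum>j<m. p j) \<le> p m" for m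
  proof (induction m)
    case (Suc m)
    then show ?case using left[of m] by simp
  qed (use nonneg in simp)
  have head: "(\<Sum>j<i. p j) \<le> 4 * p k / 15" if "k = Suc i" for i
    using lower[of i] prev_le[OF that] that by simp
  have split: "suminf p = (\<Sum>j<k. p j) + p k + p (Suc k) + (\<Sum>j. p (j + Suc (Suc k)))"
    using suminf_split_initial_segment[OF summ, of "Suc (Suc k)"] by simp
  have "(\<Sum>j<k. p j) \<le> 4 * p k / 15 + 4 * p k"
    using head prev_le nonneg by (cases k) (auto intro: add_mono)
  then show "suminf p \<le> 7 * p k"
    using split tail next_le nonneg[of k] by linarith
  fix a :: "nat \<Rightarrow> complex"
  assume a: "\<And>j. norm (a j) \<le> p j" "norm (a k) = p k" "a (Suc k) = 0" "\<And>i. k = Suc i \<Longrightarrow> a i = 0"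
  have summ_a: "summable a"
    by (rule summable_comparison_test'[OF summ, of 0]) (use a in auto)
  have split_a: "suminf a = (\<Sum>j<k. a j) + a k + (\<Sum>j. a (j + Suc (Suc k)))"
    using suminf_split_initial_segment[OF summ_a, of "Suc (Suc k)"] a(3) by simp
  have summ': "summable (\<lambda>j. p (j + Suc (Suc k)))"
    using summ by (simp only: summable_iff_shift)
  have "norm (\<Sum>j. a (j + Suc (Suc k))) \<le> (\<Sum>j. p (j + Suc (Suc k)))"
    by (intro norm_suminf_le summ') (use a in auto)
  moreover have "norm (\<Sum>j<k. a j) \<le> 4 * p k / 15"
  proof (cases k)
    case (Suc i)
    have "norm (\<Sum>j<k. a j) = norm (\<Sum>j<i. a j)" using a(4)[OF Suc] by (simp add: Suc)
    also have "\<dots> \<le> (\<Sum>j<i. p j)" by (intro sum_norm_le a(1))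
    finally show ?thesis using head[OF Suc] by simp
  qed (use nonneg in auto)
  moreover have "norm (a k) - norm (\<Sum>j<k. a j) - norm (\<Sum>j. a (j + Suc (Suc k))) \<le> norm (suminf a)"
    unfolding split_a by norm
  ultimately show "p k / 2 \<le> norm (suminf a)"
    using tail a(2) nonneg[of k] by linarith
qed

section \<open>The weighted lacunary series on the disc\<close>

locale lacunary_series = lacunary_monomials +
  fixes c :: "nat \<Rightarrow> real"
  assumes c_pos: "0 < c k" and c_decreasing: "c (Suc k) \<le> c k" and c_slow: "c k \<le> 2 * c (Suc k)"
begin

text \<open>\<open>P\<close> selects the indices, so that the choices \<open>even\<close> and
  \<open>odd\<close> share all estimates.\<close>

definition lac :: "(nat \<Rightarrow> bool) \<Rightarrow> complex \<Rightarrow> complex" where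
  "lac P z = (\<Sum>k. if P k then of_real (c k * b k) * z ^ d k else 0)"

text \<open>The \<open>k\<close>-th block is \<open>[\<rho> (k - 1), \<rho> k]\<close>, unbounded on the left for \<open>k = 0\<close>.\<close>

definition block :: "nat \<Rightarrow> real \<Rightarrow> bool" where
  "block k r \<longleftrightarrow> r \<le> \<rho> k \<and> (\<forall>i. k = Suc i \<longrightarrow> \<rho> i \<le> r)"

lemma ex_block:
  assumes "r < 1" shows "\<exists>k. block k r"
proof -
  have "\<exists>k. r \<le> \<rho> k"
    using order_tendstoD(1)[OF \<rho>_lim assms] by (auto simp: eventually_sequentially intro: less_imp_le)
  then have "r \<le> \<rho> (LEAST k. r \<le> \<rho> k)" by (rule LeastI_ex)
  moreover have "\<rho> i \<le> r" if "(LEAST k. r \<le> \<rho> k) = Suc i" for i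
    using not_less_Least[of i "\<lambda>k. r \<le> \<rho> k"] that by simp
  ultimately show ?thesis unfolding block_def by blast
qed

abbreviation term_size :: "real \<Rightarrow> nat \<Rightarrow> real" where
  "term_size r k \<equiv> c k * (b k * r ^ d k)"

context
  fixes k r assumes r: "0 \<le> r" and k: "block k r"
begin

lemma block_\<rho>: "k \<le> j \<Longrightarrow> r \<le> \<rho> j" "j < k \<Longrightarrow> \<rho> j \<le> r"
proof -
  show "r \<le> \<rho> j" if "k \<le> j" using k incseqD[OF \<rho>_mono that] by (auto simp: block_def)
  show "\<rho> j \<le> r" if j: "j < k"
  proof -
    obtain i where "k = Suc i" "j \<le> i" using j by (cases k) auto
    then show ?thesis using k incseqD[OF \<rho>_mono, of j i] by (auto simp: block_def)
  qed
qed

text \<open>To the left of the block the factor 2 lost in \<open>c_slow\<close> turns the ratio 32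
  into 16 and the neighbour bound 2 into 4. To the right the decrease of \<open>c\<close> only
  helps.\<close>

lemma
  shows term_size_nonneg: "0 \<le> term_size r j"
    and term_size_next: "term_size r (Suc k) \<le> term_size r k"
    and term_size_right: "k < j \<Longrightarrow> 16 * term_size r (Suc j) \<le> term_size r j"
    and term_size_prev: "k = Suc i \<Longrightarrow> term_size r i \<le> 4 * term_size r k"
    and term_size_left: "Suc j < k \<Longrightarrow> 16 * term_size r j \<le> term_size r (Suc j)"
proof -
  have nonneg: "0 \<le> b j * r ^ d j" for j using b_pos[of j] r by simp
  have c0: "0 \<le> c j" for j using c_pos[of j] by simp
  show "0 \<le> term_size r j" using nonneg c0 by simp
  show "term_size r (Suc k) \<le> term_size r k"
    using block_\<rho>(1)[of k] nonneg c0 r by (intro mult_mono c_decreasing up) auto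
  show "16 * term_size r (Suc j) \<le> term_size r j" if j: "k < j"
  proof -
    obtain i where i: "j = Suc i" "k \<le> i" using j by (cases j) auto
    have "16 * (b (Suc j) * r ^ d (Suc j)) \<le> b j * r ^ d j"
      using up_fast[OF r block_\<rho>(1)[OF i(2)]] nonneg[of "Suc j"] unfolding i(1) by linarith
    then have "c (Suc j) * (16 * (b (Suc j) * r ^ d (Suc j))) \<le> c j * (b j * r ^ d j)"
      by (rule mult_mono[OF c_decreasing _ c0]) (use nonneg[of "Suc j"] in simp)
    then show ?thesis by simp
  qed
  show "term_size r i \<le> 4 * term_size r k" if i: "k = Suc i"
  proof -
    have "c i * (b i * r ^ d i) \<le> (2 * c k) * (2 * (b k * r ^ d k))"
      using block_\<rho>(2)[of i] nonneg c0 r unfolding i by (intro mult_mono c_slow down) (auto simp: i)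
    then show ?thesis by simp
  qed
  show "16 * term_size r j \<le> term_size r (Suc j)" if j: "Suc j < k"
  proof -
    have "c j * (32 * (b j * r ^ d j)) \<le> (2 * c (Suc j)) * (b (Suc j) * r ^ d (Suc j))"
      using block_\<rho>(2)[of "Suc j"] nonneg c0 r j by (intro mult_mono c_slow down_fast) auto
    moreover have "c j * (32 * (b j * r ^ d j)) = 32 * term_size r j"
      "(2 * c (Suc j)) * (b (Suc j) * r ^ d (Suc j)) = 2 * term_size r (Suc j)"
      by (simp_all only: mult_ac)
    ultimately show ?thesis by linarith
  qed
qed

lemmas term_size_facts = term_size_nonneg term_size_next term_size_right term_size_prev term_size_left

lemma summable_term_size: "summable (term_size r)"
  by (rule dominated_summable[of _ k]) (fact term_size_facts)+

lemma suminf_term_size: "suminf (term_size r) \<le> 7 * term_size r k"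
  by (rule dominated_suminf_le) (fact term_size_facts)+

context
  fixes z :: complex assumes z: "cmod z = r"
begin

lemma norm_lac_le: "cmod (lac P z) \<le> 7 * term_size r k"
proof -
  have "cmod (lac P z) \<le> suminf (term_size r)"
    unfolding lac_def using z b_pos c_pos
    by (intro norm_suminf_le summable_term_size)
      (auto simp: norm_mult norm_power abs_mult less_imp_le abs_of_pos)
  then show ?thesis using suminf_term_size by linarith
qed

text \<open>Only the neighbours of \<open>k\<close> can be comparable to the \<open>k\<close>-th
  term, and \<open>P\<close> excludes them.\<close>

lemma norm_lac_ge:
  assumes "P k" "\<not> P (Suc k)" "\<And>i. k = Suc i \<Longrightarrow> \<not> P i"
  shows "term_size r k / 2 \<le> cmod (lac P z)"
proof -
  have norm_term: "cmod (of_real (c j * b j) * z ^ d j) = term_size r j" for j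
    using z b_pos[of j] c_pos[of j] by (simp add: norm_mult norm_power)
  show ?thesis
    unfolding lac_def
    by (rule dominant_term_le_norm_suminf[where p = "term_size r" and k = k],
        fact term_size_nonneg, fact term_size_next, fact term_size_right, fact term_size_prev,
        fact term_size_left)
      (use assms in \<open>simp_all add: term_size_nonneg norm_term del: of_real_mult\<close>)
qed

end
end

lemma lac_holomorphic: "lac P holomorphic_on unit_disc"
proof -
  let ?F = "\<lambda>k z :: complex. if P k then complex_of_real (c k * b k) * z ^ d k else 0"
  have "\<exists>g g'. \<forall>z\<in>unit_disc. ((\<lambda>k. ?F k z) sums g z) \<and>
      ((\<lambda>k. deriv (?F k) z) sums g' z) \<and> (g has_field_derivative g' z) (at z)"
  proof (rule series_and_derivative_comparison_local)
    show "(?F k has_field_derivative deriv (?F k) z) (at z)" for k and z :: complex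
    proof (rule holomorphic_derivI)
      show "?F k holomorphic_on UNIV" by (cases "P k") (simp_all add: holomorphic_intros)
    qed auto
  next
    fix z :: complex assume "z \<in> unit_disc"
    then have z: "cmod z < 1" by simp
    \<comment> \<open>A radius strictly between \<open>cmod z\<close> and 1: the terms at
      \<open>r\<close> form a summable majorant on the whole ball of radius
      \<open>r - cmod z\<close> around \<open>z\<close>.\<close>
    define r where "r = (1 + cmod z) / 2"
    have r: "0 \<le> r" "r < 1" "cmod z < r" using z by (auto simp: r_def)
    obtain k where k: "block k r" using ex_block[OF r(2)] by blast
    have "cmod (?F j y) \<le> term_size r j" if "y \<in> ball z (r - cmod z)" for j y
    proof -
      have "cmod y \<le> r" using that norm_triangle_ineq2[of y z] by (simp add: dist_norm norm_minus_commute)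
      then have "cmod y ^ d j \<le> r ^ d j" by (intro power_mono) auto
      then show ?thesis using b_pos[of j] c_pos[of j] r(1)
        by (auto simp: norm_mult norm_power mult.assoc)
    qed
    then show "\<exists>\<delta> h. 0 < \<delta> \<and> summable h \<and>
        (\<forall>\<^sub>F n in sequentially. \<forall>y\<in>ball z \<delta> \<inter> unit_disc. cmod (?F n y) \<le> h n)"
      using summable_term_size[OF r(1) k] r(3)
      by (intro exI[of _ "r - cmod z"] exI[of _ "term_size r"]) auto
  qed simp
  then obtain g g' where g: "\<forall>z\<in>unit_disc. ((\<lambda>k. ?F k z) sums g z) \<and>
      ((\<lambda>k. deriv (?F k) z) sums g' z) \<and> (g has_field_derivative g' z) (at z)"
    by (elim exE) (rule that)
  have "g holomorphic_on unit_disc"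
    unfolding holomorphic_on_open[OF open_ball] using g by blast
  moreover have "g z = lac P z" if "z \<in> unit_disc" for z
    unfolding lac_def using bspec[OF g that] by (intro sums_unique) simp
  ultimately show ?thesis by (rule holomorphic_transform)
qed

end

section \<open>Limits at the unit circle and slowly decaying coefficients\<close>

lemma eventually_at_unit_circle:
  assumes "a < 1" "\<And>z. \<lbrakk>a < cmod z; cmod z < 1\<rbrakk> \<Longrightarrow> P z"
  shows "eventually P at_unit_circle"
  using assms unfolding at_unit_circle_def eventually_filtercomap
  by (intro exI[of _ "\<lambda>r. a < r \<and> r < 1"]) (auto simp: eventually_at_left_field)

lemma filterlim_of_real_at_unit_circle: "filterlim complex_of_real at_unit_circle (at_left 1)"
  unfolding at_unit_circle_def filterlim_filtercomap_iff
proof (rule filterlim_cong[THEN iffD1, OF refl refl _ filterlim_ident])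
  show "eventually (\<lambda>r. r = (cmod \<circ> complex_of_real) r) (at_left (1::real))"
    by (auto simp: eventually_at_left_field intro!: exI[of _ 0])
qed

lemma growth_norm_finiteI:
  assumes "\<And>z. cmod z < 1 \<Longrightarrow> \<omega> z * cmod (f z) \<le> B"
  shows "growth_norm \<omega> f < \<infinity>"
proof -
  have "growth_norm \<omega> f \<le> ereal B"
    unfolding growth_norm_def by (rule SUP_least) (use assms in auto)
  then show ?thesis by (rule le_less_trans) simp
qed

text \<open>The slowest decay allowed is by the factor \<open>1/2\<close>: the ratio \<open>32\<close> between neighbouring
  monomials absorbs it.\<close>

fun envelope :: "(nat \<Rightarrow> real) \<Rightarrow> nat \<Rightarrow> real" where
  "envelope w 0 = w 0"
| "envelope w (Suc k) = max (envelope w k / 2) (w (Suc k))"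

lemma
  assumes "decseq w" "\<And>k. 0 < w k"
  shows envelope_ge: "w k \<le> envelope w k"
    and envelope_pos: "0 < envelope w k"
    and envelope_decreasing: "envelope w (Suc k) \<le> envelope w k"
    and envelope_slow: "envelope w k \<le> 2 * envelope w (Suc k)"
proof -
  show ge: "w k \<le> envelope w k" for k by (cases k) auto
  show pos: "0 < envelope w k" for k using ge assms(2) less_le_trans by blast
  show "envelope w (Suc k) \<le> envelope w k"
    using ge[of k] pos[of k] decseqD[OF assms(1), of k "Suc k"] by simp
  show "envelope w k \<le> 2 * envelope w (Suc k)" by simp
qed

text \<open>The sequence decreases to some \<open>l\<close>; passing to the limit in the recursion
  gives \<open>l = max (l / 2) 0\<close>, hence \<open>l = 0\<close>.\<close>

lemma envelope_tendsto_0: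
  assumes "decseq w" "\<And>k. 0 < w k" "w \<longlonglongrightarrow> 0"
  shows "envelope w \<longlonglongrightarrow> 0"
proof -
  note facts = envelope_pos[OF assms(1,2)] envelope_decreasing[OF assms(1,2)]
  obtain l where l: "envelope w \<longlonglongrightarrow> l" "\<forall>k. l \<le> envelope w k"
    using decseq_convergent[of "envelope w" 0] facts by (metis decseq_SucI less_imp_le)
  have "(\<lambda>k. max (envelope w k / 2) (w (Suc k))) \<longlonglongrightarrow> max (l / 2) 0"
    by (intro tendsto_max tendsto_divide l tendsto_const LIMSEQ_Suc assms(3)) auto
  then have "(\<lambda>k. envelope w (Suc k)) \<longlonglongrightarrow> max (l / 2) 0"
    by (simp only: envelope.simps)
  then have "max (l / 2) 0 = l"
    by (rule LIMSEQ_unique) (rule LIMSEQ_Suc[OF l(1)])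
  then have "l = 0" by (simp add: max_def split: if_splits)
  then show ?thesis using l by simp
qed

section \<open>Choice of the coefficients, membership in the space, and the lower bound\<close>

theorem theorem1p1:
  fixes \<omega> :: "complex \<Rightarrow> real" and W :: "real \<Rightarrow> real"
  assumes "radial_weight \<omega>"
    and "\<exists>v. log_convex v \<and> equivalent_on_disc (\<lambda>z. 1 / \<omega> z) v"
    and "piecewise_continuous_on {0..<1} W"
    and "antimono_on {0..<1} W"
    and "\<forall>r\<in>{0..<1}. W r > 0"
    and "(W \<longlongrightarrow> 0) (at_left 1)"
  shows "\<exists>f\<in>little_growth_space \<omega>. \<exists>g\<in>little_growth_space \<omega>.
           \<forall>z\<in>unit_disc. cmod (f z) + cmod (g z) \<ge> W (cmod z) / \<omega> (complex_of_real (cmod z))"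
proof -
  have \<omega>_pos: "0 < \<omega> z" and \<omega>_radial: "\<omega> z = \<omega> (of_real (cmod z))" if "cmod z < 1" for z
    using assms(1) that unfolding radial_weight_def positive_radial_def
    by (metis mem_ball_0)+
  have \<omega>_le: "\<omega> z \<le> \<omega> w" if "cmod w \<le> cmod z" "cmod z < 1" for w z
  proof (cases "cmod w = cmod z")
    case True
    then show ?thesis using \<omega>_radial that by (metis order_refl)
  next
    case False
    then have "\<omega> z < \<omega> w"
      using assms(1) that unfolding radial_weight_def by force
    then show ?thesis by simp
  qed
  obtain v C where v: "log_convex v" and C: "0 < C"
    and v_ge: "\<And>z. cmod z < 1 \<Longrightarrow> 1 / (\<omega> z * C) \<le> v z" and v_le: "\<And>z. cmod z < 1 \<Longrightarrow> v z \<le> C / \<omega> z"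
    using assms(2) by (auto simp: equivalent_on_disc_def)
  define V where "V r = v (of_real r)" for r
  interpret V: log_convex_growth V "1 / (\<omega> 0 * C)"
  proof
    show "convex_on {..<0} (\<lambda>x. ln (V (exp x)))"
      using v by (simp add: log_convex_def V_def)
    show "0 < 1 / (\<omega> 0 * C)" using \<omega>_pos[of 0] C by simp
    show "1 / (\<omega> 0 * C) \<le> V r" if "0 < r" "r < 1" for r
    proof -
      have "1 / (\<omega> 0 * C) \<le> 1 / (\<omega> r * C)"
        using that \<omega>_pos[of r] C \<omega>_le[of 0 r] by (intro divide_left_mono mult_right_mono) auto
      also have "\<dots> \<le> V r" using v_ge[of r] that by (simp add: V_def)
      finally show ?thesis .
    qed
    have "((\<lambda>r. \<omega> (of_real r) * C) \<longlongrightarrow> 0 * C) (at_left 1)"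
      using assms(1) by (intro tendsto_mult_right filterlim_compose[OF _ filterlim_of_real_at_unit_circle])
        (auto simp: radial_weight_def)
    moreover have interval: "eventually (\<lambda>r. 0 < r \<and> r < 1) (at_left (1::real))"
      by (auto simp: eventually_at_left_field intro!: exI[of _ 0])
    moreover have "eventually (\<lambda>r. 0 < \<omega> (of_real r) * C) (at_left 1)"
      using interval by eventually_elim (use \<omega>_pos C in auto)
    ultimately have "filterlim (\<lambda>r. inverse (\<omega> (of_real r) * C)) at_top (at_left 1)"
      by (intro filterlim_inverse_at_top) auto
    then show "filterlim V at_top (at_left 1)"
      by (rule filterlim_at_top_mono)
        (use interval in eventually_elim, use v_ge in \<open>auto simp: V_def inverse_eq_divide\<close>)
  qed
  obtain b d \<rho> D where lac: "lacunary_monomials b d \<rho>"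
    and V_le: "\<And>k r. \<lbrakk>\<rho> k \<le> r; r \<le> \<rho> (Suc k)\<rbrakk> \<Longrightarrow> V r \<le> 64 * (b (Suc k) * r ^ d (Suc k))"
    and "0 < D" and le_V: "\<And>k r. \<lbrakk>1 / 2 \<le> r; r < 1\<rbrakk> \<Longrightarrow> b k * r ^ d k \<le> D * V r"
    using V.ex_lacunary_majorant by blast
  interpret lacunary_monomials b d \<rho> by (rule lac)
  \<comment> \<open>In blocks \<open>k > 0\<close>, \<open>128 * C\<close> combines 64 from
    \<open>V_le\<close>, \<open>C\<close> from the equivalence and 2 for the halving in
    \<open>norm_lac_ge\<close>. The other entry serves block 0, where the monomial is the constant
    \<open>b 0\<close> and \<open>1 / \<omega>\<close> is largest at
    \<open>\<rho> 0\<close>.\<close>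
  define \<kappa> where "\<kappa> = max (128 * C) (2 / (b 0 * \<omega> (\<rho> 0)))"
  have \<kappa>_pos: "0 < \<kappa>" using C by (simp add: \<kappa>_def less_max_iff_disj)
  \<comment> \<open>\<open>W\<close> is evaluated at the left end of block \<open>k\<close>, where
    it is largest on the block; for \<open>k = 0\<close> that end is the origin.\<close>
  define w where "w k = \<kappa> * W (case k of 0 \<Rightarrow> 0 | Suc i \<Rightarrow> \<rho> i)" for k
  have \<rho>_ge0: "0 \<le> \<rho> k" for k using \<rho>_half[of k] by linarith
  have W_mono: "W s \<le> W r" if "0 \<le> r" "r \<le> s" "s < 1" for r s
    using assms(4) that by (auto simp: monotone_on_def)
  have w_pos: "0 < w k" for k
    using \<kappa>_pos assms(5) \<rho>_ge0 \<rho>_less by (auto simp: w_def split: nat.split)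
  have w_dec: "decseq w"
    using \<kappa>_pos \<rho>_ge0 \<rho>_less incseq_SucD[OF \<rho>_mono]
    by (intro decseq_SucI) (auto simp: w_def intro!: W_mono split: nat.split)
  have "filterlim \<rho> (at_left 1) sequentially"
    using \<rho>_lim \<rho>_less by (auto simp: filterlim_at intro!: always_eventually less_imp_neq)
  then have "(\<lambda>k. \<kappa> * W (\<rho> k)) \<longlonglongrightarrow> \<kappa> * 0"
    by (intro tendsto_mult_left filterlim_compose[OF assms(6)])
  then have "(\<lambda>k. w (Suc k)) \<longlonglongrightarrow> 0" by (simp add: w_def)
  then have w_lim: "w \<longlonglongrightarrow> 0" by (rule LIMSEQ_imp_Suc)
  define c where "c = envelope w"
  interpret lacunary_series b d \<rho> c
    unfolding c_def
    by unfold_locales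
      (fact envelope_pos[OF w_dec w_pos] envelope_decreasing[OF w_dec w_pos]
        envelope_slow[OF w_dec w_pos])+
  have c_dec: "decseq c" using c_decreasing by (rule decseq_SucI)
  \<comment> \<open>7 comes from \<open>norm_lac_le\<close>; the summands cover radii from
    \<open>1 / 2\<close> on and radii below \<open>1 / 2\<close>, respectively.\<close>
  define M where "M = 7 * (D * C + b 0 * \<omega> 0)"
  have "0 < M" using \<open>0 < D\<close> C b_pos[of 0] \<omega>_pos[of 0] by (simp add: M_def add_pos_pos)
  have upper: "\<omega> z * cmod (lac P z) \<le> c k * M" if z: "cmod z < 1" and k: "block k (cmod z)" for P z k
  proof -
    define r where "r = cmod z"
    have r: "0 \<le> r" "r < 1" using z by (auto simp: r_def)
    have \<omega>_z: "0 < \<omega> z" "\<omega> z \<le> \<omega> 0"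
      using \<omega>_pos[OF z] \<omega>_le[of 0 z] z by simp_all
    have \<omega>_r: "\<omega> (of_real r) = \<omega> z"
      unfolding r_def by (rule \<omega>_radial[OF z, symmetric])
    have "\<omega> z * (b k * r ^ d k) \<le> D * C + b 0 * \<omega> 0"
    proof (cases "1 / 2 \<le> r")
      case True
      have "\<omega> z * (b k * r ^ d k) \<le> \<omega> z * (D * V r)"
        using \<omega>_z le_V[OF True r(2)] by (intro mult_left_mono) auto
      also have "\<dots> \<le> \<omega> z * (D * (C / \<omega> z))"
        using \<omega>_z \<omega>_r v_le[of "of_real r"] r \<open>0 < D\<close> by (intro mult_left_mono) (auto simp: V_def)
      also have "\<dots> = D * C" using \<omega>_z by simp
      finally show ?thesis using b_pos[of 0] \<omega>_pos[of 0] by (simp add: add_increasing2)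
    next
      case False
      \<comment> \<open>All \<open>\<rho> i\<close> are at least \<open>1 / 2\<close>, so a smaller
        radius lies in the first block only, where \<open>d 0 = 0\<close>.\<close>
      have "k = 0"
      proof (cases k)
        case (Suc i)
        then show ?thesis using k \<rho>_half[of i] False by (auto simp: block_def r_def)
      qed
      then have "\<omega> z * (b k * r ^ d k) \<le> \<omega> 0 * b 0"
        using d_0 \<omega>_z b_pos[of 0] by simp
      then show ?thesis using \<open>0 < D\<close> C by (simp add: mult.commute add_increasing)
    qed
    then have "c k * 7 * (\<omega> z * (b k * r ^ d k)) \<le> c k * 7 * (D * C + b 0 * \<omega> 0)"
      using c_pos[of k] by (intro mult_left_mono) auto
    moreover have "\<omega> z * cmod (lac P z) \<le> \<omega> z * (7 * (c k * (b k * r ^ d k)))"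
      using \<omega>_z by (intro mult_left_mono norm_lac_le[OF r(1) _ r_def[symmetric]]) (auto simp: r_def k)
    ultimately show ?thesis by (simp add: M_def algebra_simps)
  qed
  have in_space: "lac P \<in> little_growth_space \<omega>" for P
  proof -
    have "\<omega> z * cmod (lac P z) \<le> c 0 * M" if z: "cmod z < 1" for z
    proof -
      obtain k where "block k (cmod z)" using ex_block[OF z] by blast
      then have "\<omega> z * cmod (lac P z) \<le> c k * M" by (rule upper[OF z])
      also have "\<dots> \<le> c 0 * M" using decseqD[OF c_dec, of 0 k] \<open>0 < M\<close> by (intro mult_right_mono) auto
      finally show ?thesis .
    qed
    then have "growth_norm \<omega> (lac P) < \<infinity>" by (rule growth_norm_finiteI)
    moreover have "((\<lambda>z. \<omega> z * cmod (lac P z)) \<longlongrightarrow> 0) at_unit_circle"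
    proof (rule tendstoI)
      fix e :: real assume "0 < e"
      have "(\<lambda>k. c k * M) \<longlonglongrightarrow> 0 * M"
        unfolding c_def by (intro tendsto_mult_right envelope_tendsto_0 w_dec w_pos w_lim)
      then have "eventually (\<lambda>k. c k * M < e) sequentially"
        using \<open>0 < e\<close> by (intro order_tendstoD(2)) auto
      then obtain K where K: "c K * M < e" by (auto simp: eventually_sequentially)
      show "eventually (\<lambda>z. dist (\<omega> z * cmod (lac P z)) 0 < e) at_unit_circle"
      proof (rule eventually_at_unit_circle[OF \<rho>_less[of K]])
        fix z assume z: "\<rho> K < cmod z" "cmod z < 1"
        obtain k where k: "block k (cmod z)" using ex_block[OF z(2)] by blast
        \<comment> \<open>Beyond \<open>\<rho> K\<close> only blocks of index at least
          \<open>K\<close> occur, so the bound \<open>c k * M\<close> tends to 0 at the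
          circle.\<close>
        have "K \<le> k"
          using z(1) block_\<rho>(1)[OF _ k, of K] by (meson le_cases norm_ge_zero not_le)
        have "\<omega> z * cmod (lac P z) \<le> c k * M" by (rule upper[OF z(2) k])
        also have "\<dots> \<le> c K * M"
          using decseqD[OF c_dec \<open>K \<le> k\<close>] \<open>0 < M\<close> by (intro mult_right_mono) auto
        finally show "dist (\<omega> z * cmod (lac P z)) 0 < e"
          using K \<omega>_pos[OF z(2)] by (simp add: abs_mult)
      qed
    qed
    ultimately show ?thesis
      using lac_holomorphic by (simp add: little_growth_space_def growth_space_def)
  qed
  have "W (cmod z) / \<omega> (of_real (cmod z)) \<le> cmod (lac even z) + cmod (lac odd z)" if z: "cmod z < 1" for z
  proof -
    define r where "r = cmod z"
    have r: "0 \<le> r" "r < 1" using z by (auto simp: r_def)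
    have \<omega>_r: "0 < \<omega> (of_real r)" using \<omega>_pos[of "of_real r"] r by simp
    have W_r: "0 < W r" "0 < W 0" using assms(5) r by simp_all
    obtain k where k: "block k r" using ex_block[OF r(2)] by blast
    have c_ge: "w k \<le> c k" unfolding c_def by (rule envelope_ge[OF w_dec w_pos])
    have t: "0 \<le> b k * r ^ d k" using b_pos[of k] r by simp
    have "2 * (W r / \<omega> (of_real r)) \<le> c k * (b k * r ^ d k)"
    proof (cases k)
      case 0
      have "2 / (b 0 * \<omega> (\<rho> 0)) \<le> \<kappa>" by (simp add: \<kappa>_def)
      moreover have pos: "0 < \<omega> (\<rho> 0)" using \<omega>_pos[of "\<rho> 0"] \<rho>_less[of 0] \<rho>_ge0[of 0] by simp
      ultimately have "2 / \<omega> (\<rho> 0) \<le> \<kappa> * b 0" using b_pos[of 0] by (simp add: field_simps)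
      have "2 * (W r / \<omega> (of_real r)) \<le> 2 * (W 0 / \<omega> (\<rho> 0))"
        using k 0 r pos W_r \<rho>_less[of 0] \<rho>_ge0[of 0]
        by (intro mult_left_mono frac_le W_mono \<omega>_le) (auto simp: block_def)
      also have "\<dots> = W 0 * (2 / \<omega> (\<rho> 0))" by simp
      also have "\<dots> \<le> W 0 * (\<kappa> * b 0)"
        using assms(5) \<open>2 / \<omega> (\<rho> 0) \<le> \<kappa> * b 0\<close> by (intro mult_left_mono) (auto intro: less_imp_le)
      also have "\<dots> = w 0 * b 0" by (simp add: w_def)
      also have "\<dots> \<le> c 0 * b 0" using c_ge b_pos[of 0] 0 by (intro mult_right_mono) auto
      finally show ?thesis using d_0 0 by simp
    next
      case (Suc i)
      have \<rho>_i: "\<rho> i \<le> r" "r \<le> \<rho> (Suc i)" using k Suc by (auto simp: block_def)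
      have "1 / (\<omega> (of_real r) * C) \<le> V r" using v_ge[of "of_real r"] r by (simp add: V_def)
      also have "\<dots> \<le> 64 * (b k * r ^ d k)" using V_le[OF \<rho>_i] Suc by simp
      finally have "2 / \<omega> (of_real r) \<le> 128 * C * (b k * r ^ d k)"
        using C \<omega>_r by (simp add: field_simps)
      also have "\<dots> \<le> \<kappa> * (b k * r ^ d k)" using t by (intro mult_right_mono) (auto simp: \<kappa>_def)
      finally have "W r * (2 / \<omega> (of_real r)) \<le> W (\<rho> i) * (\<kappa> * (b k * r ^ d k))"
        using W_mono[OF \<rho>_ge0 \<rho>_i(1) r(2)] W_r \<omega>_r by (intro mult_mono) auto
      also have "\<dots> = w k * (b k * r ^ d k)" by (simp add: w_def Suc)
      also have "\<dots> \<le> c k * (b k * r ^ d k)" using c_ge t by (rule mult_right_mono)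
      finally show ?thesis by (simp add: mult.commute)
    qed
    \<comment> \<open>The neighbours of \<open>k\<close> have the other parity, so the series with
      the parity of \<open>k\<close> contains the dominant term without them.\<close>
    moreover have "c k * (b k * r ^ d k) / 2 \<le> cmod (lac even z) + cmod (lac odd z)"
    proof (cases "even k")
      case True
      then have "c k * (b k * r ^ d k) / 2 \<le> cmod (lac even z)"
        by (intro norm_lac_ge r(1) k) (auto simp: r_def)
      then show ?thesis by (simp add: add_increasing2)
    next
      case False
      then have "c k * (b k * r ^ d k) / 2 \<le> cmod (lac odd z)"
        by (intro norm_lac_ge r(1) k) (auto simp: r_def)
      then show ?thesis by (simp add: add_increasing)
    qed
    ultimately show ?thesis by (simp add: r_def)
  qed
  then show ?thesis
    by (intro bexI[OF _ in_space[of even]] bexI[OF _ in_space[of odd]]) auto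
qed

end
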